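(* Let $X$ be a normal $\mathcal{D}$-simple affine variety and $W$ a finite group acting on $X$. Then the map $H\mapsto\mathcal{D}(X)^H$ is a bijection between the set of subgroups $H$ of $W$ and the set of subalgebras of $\mathcal{D}(X)$ containing $\mathcal{D}(X)^W$.
   Context: Varieties are over $\mathbb{C}$ and irreducible. $\mathcal{D}(X)$ is the algebra of ($\mathbb{C}$-linear, Grothendieck) differential operators on $\mathcal{O}(X)$, filtered by order, with commutative associated graded algebra $\overline{\mathcal{D}}(X)$; $W$ acts on it by conjugation. $X$ is $\mathcal{D}$-simple if $\overline{\mathcal{D}}(X)$ is a finitely generated $\mathbb{C}$-algebra and $\mathcal{D}(X)$ is a simple ring.
   Formalization: The action of W on X is assumed to be faithful; otherwise the trivial subgroup and the kernel of the action have the same invariants in D(X), so the map is not injective. *)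

theory Defs
  imports "HOL-Algebra.Group" "HOL-Computational_Algebra.Polynomial"
          "HOL-Computational_Algebra.Fraction_Field" Complex_Main
begin

text \<open>A commutative C-algebra is modelled as a commutative ring (here an integral
 domain, the coordinate ring of an irreducible affine variety) together with a
 ring homomorphism c from the complex numbers.\<close>

definition calg_struct :: "(complex \<Rightarrow> 'a::comm_ring_1) \<Rightarrow> bool" where
  "calg_struct c \<longleftrightarrow> c 1 = 1 \<and> (\<forall>z w. c (z + w) = c z + c w) \<and> (\<forall>z w. c (z * w) = c z * c w)"

definition calg_generated :: "(complex \<Rightarrow> 'a::comm_ring_1) \<Rightarrow> 'a set \<Rightarrow> 'a set" where
  "calg_generated c S = \<Inter>{B. range c \<subseteq> B \<and> S \<subseteq> B \<and>
      (\<forall>x\<in>B. \<forall>y\<in>B. x + y \<in> B \<and> x * y \<in> B)}"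

definition fin_gen_calg :: "(complex \<Rightarrow> 'a::comm_ring_1) \<Rightarrow> bool" where
  "fin_gen_calg c \<longleftrightarrow> (\<exists>S. finite S \<and> calg_generated c S = UNIV)"

definition affine_coord_ring :: "(complex \<Rightarrow> 'a::idom) \<Rightarrow> bool" where
  "affine_coord_ring c \<longleftrightarrow> calg_struct c \<and> fin_gen_calg c"

definition integrally_closed :: "'a::idom itself \<Rightarrow> bool" where
  "integrally_closed _ \<longleftrightarrow>
     (\<forall>x :: 'a fract. (\<exists>p :: 'a poly. lead_coeff p = 1 \<and> poly (map_poly (\<lambda>a. Fract a 1) p) x = 0)
        \<longrightarrow> (\<exists>a. x = Fract a 1))"

definition clinear_map :: "(complex \<Rightarrow> 'a::comm_ring_1) \<Rightarrow> ('a \<Rightarrow> 'a) \<Rightarrow> bool" where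
  "clinear_map c \<theta> \<longleftrightarrow> (\<forall>x y. \<theta> (x + y) = \<theta> x + \<theta> y) \<and> (\<forall>z x. \<theta> (c z * x) = c z * \<theta> x)"

primrec diffops_le :: "(complex \<Rightarrow> 'a::comm_ring_1) \<Rightarrow> nat \<Rightarrow> ('a \<Rightarrow> 'a) set" where
  "diffops_le c 0 = {\<theta>. clinear_map c \<theta> \<and> (\<forall>a x. \<theta> (a * x) = a * \<theta> x)}"
| "diffops_le c (Suc n) = {\<theta>. clinear_map c \<theta> \<and> (\<forall>a. (\<lambda>x. \<theta> (a * x) - a * \<theta> x) \<in> diffops_le c n)}"

definition diffops_lt :: "(complex \<Rightarrow> 'a::comm_ring_1) \<Rightarrow> nat \<Rightarrow> ('a \<Rightarrow> 'a) set" where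
  "diffops_lt c n = (if n = 0 then {\<lambda>_. 0} else diffops_le c (n - 1))"

definition diffops :: "(complex \<Rightarrow> 'a::comm_ring_1) \<Rightarrow> ('a \<Rightarrow> 'a) set" where
  "diffops c = (\<Union>n. diffops_le c n)"

definition cspan :: "(complex \<Rightarrow> 'a::comm_ring_1) \<Rightarrow> ('a \<Rightarrow> 'a) set \<Rightarrow> ('a \<Rightarrow> 'a) set" where
  "cspan c M = {f. \<exists>zs :: (complex \<times> ('a \<Rightarrow> 'a)) list. set (map snd zs) \<subseteq> M \<and>
                   f = (\<lambda>x. \<Sum>(z, m) \<leftarrow> zs. c z * m x)}"

text \<open>The associated graded algebra gr D = (+)_n D^n / D^(n-1) is finitely generated
  (equivalently by finitely many homogeneous elements, the symbols sigma_k(theta) of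
  pairs (k, theta) with theta in D^k): every element of D^n / D^(n-1) is a C-linear
  combination of products of generators of total degree n.\<close>
definition gr_fin_gen :: "(complex \<Rightarrow> 'a::comm_ring_1) \<Rightarrow> bool" where
  "gr_fin_gen c \<longleftrightarrow> (\<exists>S :: (nat \<times> ('a \<Rightarrow> 'a)) set. finite S \<and>
      (\<forall>(k, \<theta>) \<in> S. \<theta> \<in> diffops_le c k) \<and>
      (\<forall>n. \<forall>\<theta> \<in> diffops_le c n. \<exists>\<psi> \<in> cspan c {foldr (\<circ>) (map snd ps) id | ps.
               set ps \<subseteq> S \<and> sum_list (map fst ps) = n}.
           (\<lambda>x. \<theta> x - \<psi> x) \<in> diffops_lt c n))"

definition diffops_simple :: "(complex \<Rightarrow> 'a::comm_ring_1) \<Rightarrow> bool" where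
  "diffops_simple c \<longleftrightarrow>
     (\<forall>I. I \<subseteq> diffops c \<and> (\<lambda>_. 0) \<in> I \<and>
          (\<forall>f\<in>I. \<forall>g\<in>I. (\<lambda>x. f x - g x) \<in> I) \<and>
          (\<forall>f\<in>I. \<forall>d\<in>diffops c. d \<circ> f \<in> I \<and> f \<circ> d \<in> I)
        \<longrightarrow> I = {\<lambda>_. 0} \<or> I = diffops c)"

definition D_simple :: "(complex \<Rightarrow> 'a::comm_ring_1) \<Rightarrow> bool" where
  "D_simple c \<longleftrightarrow> gr_fin_gen c \<and> diffops_simple c"

definition calg_aut :: "(complex \<Rightarrow> 'a::comm_ring_1) \<Rightarrow> ('a \<Rightarrow> 'a) \<Rightarrow> bool" where
  "calg_aut c \<sigma> \<longleftrightarrow> bij \<sigma> \<and> (\<forall>x y. \<sigma> (x + y) = \<sigma> x + \<sigma> y) \<and>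
      (\<forall>x y. \<sigma> (x * y) = \<sigma> x * \<sigma> y) \<and> \<sigma> 1 = 1 \<and> (\<forall>z. \<sigma> (c z) = c z)"

text \<open>A (faithful) action of the group W on X, given by the induced action on O(X)
  by C-algebra automorphisms: g acts as act g.\<close>
definition faithful_action :: "(complex \<Rightarrow> 'a::comm_ring_1) \<Rightarrow> ('g, 'b) monoid_scheme \<Rightarrow> ('g \<Rightarrow> 'a \<Rightarrow> 'a) \<Rightarrow> bool" where
  "faithful_action c W act \<longleftrightarrow>
     (\<forall>g\<in>carrier W. calg_aut c (act g)) \<and>
     (\<forall>g\<in>carrier W. \<forall>h\<in>carrier W. act (g \<otimes>\<^bsub>W\<^esub> h) = act g \<circ> act h) \<and>
     inj_on act (carrier W)"

definition diffops_inv :: "(complex \<Rightarrow> 'a::comm_ring_1) \<Rightarrow> ('g, 'b) monoid_scheme \<Rightarrow> ('g \<Rightarrow> 'a \<Rightarrow> 'a) \<Rightarrow> 'g set \<Rightarrow> ('a \<Rightarrow> 'a) set" where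
  "diffops_inv c W act H = {\<theta> \<in> diffops c. \<forall>h\<in>H. act h \<circ> \<theta> \<circ> act (inv\<^bsub>W\<^esub> h) = \<theta>}"

definition diffops_subalg :: "(complex \<Rightarrow> 'a::comm_ring_1) \<Rightarrow> ('a \<Rightarrow> 'a) set \<Rightarrow> bool" where
  "diffops_subalg c B \<longleftrightarrow> B \<subseteq> diffops c \<and> id \<in> B \<and>
     (\<forall>f\<in>B. \<forall>g\<in>B. (\<lambda>x. f x + g x) \<in> B \<and> f \<circ> g \<in> B) \<and>
     (\<forall>z. \<forall>f\<in>B. (\<lambda>x. c z * f x) \<in> B)"

end

theory Submission
  imports Defs
begin

text \<open>
  Write \<open>D\<close> for the ring of differential operators on the coordinate ring \<open>O\<close>, let \<open>S\<close> lie between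
  \<open>D\<^sup>W\<close> and \<open>D\<close>, let \<open>H\<close> be the pointwise stabiliser of \<open>P = S \<inter> O\<close> and \<open>T = D\<^sup>H\<close>. A generic
  \<open>\<theta> \<in> P\<close> has stabiliser \<open>H\<close>; if \<open>q\<close> is its minimal polynomial over \<open>O\<^sup>W\<close> divided by \<open>X - \<theta>\<close> and
  \<open>f = q(\<theta>)\<close>, then \<open>|H| f t\<close> equals the sum of \<open>q\<^sub>i tr\<^sub>W(\<theta>\<^sup>i t)\<close> for \<open>t \<in> T\<close>. Hence \<open>f T\<close> and,
  symmetrically, \<open>T f\<close> are contained in \<open>S\<close>, and so is \<open>T f\<^sup>2 T\<close>. As \<open>D\<close> is simple and \<open>W\<close> acts by
  outer automorphisms, \<open>T f\<^sup>2 T = T\<close>, thus \<open>T \<subseteq> S\<close>. Conversely, for \<open>s \<in> S\<close> and \<open>h \<in> H\<close>, induction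
  on the order shows that \<open>s - h(s)\<close> commutes with \<open>O\<^sup>W\<close> and so has order zero. Therefore \<open>s\<close> differs
  from its average over \<open>H\<close> by an element of \<open>P\<close>, and \<open>s \<in> T\<close>.
\<close>

section \<open>Linear maps and the order filtration on differential operators\<close>

lemma clinear_map_add: "clinear_map c \<theta> \<Longrightarrow> \<theta> (x + y) = \<theta> x + \<theta> y"
  by (auto simp: clinear_map_def)

lemma
  fixes f :: "'a::ab_group_add \<Rightarrow> 'b::ab_group_add"
  assumes add: "\<And>x y. f (x + y) = f x + f y"
  shows additive_imp_zero: "f 0 = 0"
    and additive_imp_diff: "f (x - y) = f x - f y"
    and additive_imp_sum: "f (\<Sum>i\<in>A. g i) = (\<Sum>i\<in>A. f (g i))"
proof -
  show z: "f 0 = 0" using add[of 0 0] by simp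
  show "f (x - y) = f x - f y" using add[of "x - y" y] by simp
  show "f (\<Sum>i\<in>A. g i) = (\<Sum>i\<in>A. f (g i))"
    by (induction A rule: infinite_finite_induct) (simp_all add: z add)
qed

lemma
  assumes "clinear_map c \<theta>"
  shows clinear_map_zero: "\<theta> 0 = 0"
    and clinear_map_diff: "\<theta> (x - y) = \<theta> x - \<theta> y"
    and clinear_map_sum: "\<theta> (\<Sum>i\<in>A. g i) = (\<Sum>i\<in>A. \<theta> (g i))"
  using additive_imp_zero[of \<theta>] additive_imp_diff[of \<theta>] additive_imp_sum[of \<theta>]
    clinear_map_add[OF assms] by blast+

lemma clinear_map_mult: "clinear_map c ((*) a)"
  by (auto simp: clinear_map_def algebra_simps)

lemma clinear_map_comp: "clinear_map c f \<Longrightarrow> clinear_map c g \<Longrightarrow> clinear_map c (f \<circ> g)"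
  by (auto simp: clinear_map_def)

text \<open>This is the bracket of \<open>\<theta>\<close> with the operator of multiplication by
  \<open>a\<close>, the expression on which the recursion of \<open>diffops_le\<close>
  descends.\<close>

definition mult_commutator :: "('a::comm_ring_1 \<Rightarrow> 'a) \<Rightarrow> 'a \<Rightarrow> 'a \<Rightarrow> 'a" where
  "mult_commutator \<theta> a = (\<lambda>x. \<theta> (a * x) - a * \<theta> x)"

lemma diffops_le_Suc_iff:
  "\<theta> \<in> diffops_le c (Suc n) \<longleftrightarrow>
     clinear_map c \<theta> \<and> (\<forall>a. mult_commutator \<theta> a \<in> diffops_le c n)"
  by (simp add: mult_commutator_def)

lemma mult_commutator_in_diffops_le:
  "\<theta> \<in> diffops_le c (Suc n) \<Longrightarrow> mult_commutator \<theta> a \<in> diffops_le c n"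
  by (simp add: mult_commutator_def)

lemma diffops_le_clinear: "\<theta> \<in> diffops_le c n \<Longrightarrow> clinear_map c \<theta>"
  by (cases n) auto

text \<open>A map that is linear over the whole coordinate ring is determined by its value at
  \<open>1\<close>.\<close>

lemma diffops_le_0_iff: "\<theta> \<in> diffops_le c 0 \<longleftrightarrow> (\<exists>a. \<theta> = (*) a)"
proof
  assume "\<theta> \<in> diffops_le c 0"
  then have "\<theta> (x * 1) = \<theta> 1 * x" for x
    unfolding diffops_le.simps mem_Collect_eq by (metis mult.commute)
  then show "\<exists>a. \<theta> = (*) a" by auto
qed (auto simp: clinear_map_mult algebra_simps)

lemma mult_commutator_order_0: "\<theta> \<in> diffops_le c 0 \<Longrightarrow> mult_commutator \<theta> a = (\<lambda>_. 0)"
  by (auto simp: mult_commutator_def)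

lemma zero_in_diffops_le: "(\<lambda>_. 0) \<in> diffops_le c n"
  by (induction n) (auto simp: clinear_map_def)

lemma diffops_le_Suc: "\<theta> \<in> diffops_le c n \<Longrightarrow> \<theta> \<in> diffops_le c (Suc n)"
proof (induction n arbitrary: \<theta>)
  case 0
  then show ?case
    unfolding diffops_le_Suc_iff
    by (simp add: diffops_le_clinear mult_commutator_order_0 zero_in_diffops_le del: diffops_le.simps)
next
  case (Suc n)
  then show ?case
    unfolding diffops_le_Suc_iff[of _ _ "Suc n"]
    by (simp add: diffops_le_clinear mult_commutator_in_diffops_le del: diffops_le.simps)
qed

lemma diffops_le_mono: "m \<le> n \<Longrightarrow> \<theta> \<in> diffops_le c m \<Longrightarrow> \<theta> \<in> diffops_le c n"
  by (induction n rule: dec_induct) (auto intro: diffops_le_Suc simp del: diffops_le.simps)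

lemma diffops_le_add:
  "f \<in> diffops_le c n \<Longrightarrow> g \<in> diffops_le c n \<Longrightarrow> (\<lambda>x. f x + g x) \<in> diffops_le c n"
proof (induction n arbitrary: f g)
  case (Suc n)
  have "mult_commutator (\<lambda>x. f x + g x) a = (\<lambda>x. mult_commutator f a x + mult_commutator g a x)" for a
    by (auto simp: mult_commutator_def algebra_simps)
  with Suc show ?case
    by (auto simp: diffops_le_Suc_iff clinear_map_def algebra_simps simp del: diffops_le.simps)
qed (auto simp: clinear_map_def algebra_simps)

text \<open>The bracket with \<open>a\<close> obeys the Leibniz rule for composition, and each of
  its two terms has total order one less. Hence the induction on \<open>m + n\<close>.\<close>

lemma diffops_le_comp:
  "f \<in> diffops_le c m \<Longrightarrow> g \<in> diffops_le c n \<Longrightarrow> f \<circ> g \<in> diffops_le c (m + n)"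
proof (induction "m + n" arbitrary: f g m n)
  case 0
  then show ?case by (auto simp: clinear_map_def)
next
  case (Suc k)
  note cl = diffops_le_clinear[OF Suc.prems(1)] diffops_le_clinear[OF Suc.prems(2)]
  have "mult_commutator (f \<circ> g) a \<in> diffops_le c k" for a
  proof -
    have eq: "mult_commutator (f \<circ> g) a =
        (\<lambda>x. (f \<circ> mult_commutator g a) x + (mult_commutator f a \<circ> g) x)"
      by (auto simp: mult_commutator_def clinear_map_diff[OF cl(1)])
    have "f \<circ> mult_commutator g a \<in> diffops_le c k"
    \<comment> \<open>Order zero has no predecessor: there the bracket vanishes instead of dropping
      in order.\<close>
    proof (cases n)
      case 0
      with Suc.prems have "f \<circ> mult_commutator g a = (\<lambda>_. 0)"
        by (simp add: mult_commutator_order_0 comp_def clinear_map_zero[OF cl(1)] del: diffops_le.simps)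
      then show ?thesis by (simp add: zero_in_diffops_le)
    next
      case (Suc n')
      with Suc.hyps Suc.prems show ?thesis
        by (metis add_Suc_right mult_commutator_in_diffops_le nat.inject)
    qed
    moreover have "mult_commutator f a \<circ> g \<in> diffops_le c k"
    proof (cases m)
      case 0
      with Suc.prems have "mult_commutator f a \<circ> g = (\<lambda>_. 0)"
        by (simp add: mult_commutator_order_0 comp_def del: diffops_le.simps)
      then show ?thesis by (simp add: zero_in_diffops_le)
    next
      case (Suc m')
      with Suc.hyps Suc.prems show ?thesis
        by (metis add_Suc mult_commutator_in_diffops_le nat.inject)
    qed
    ultimately show ?thesis unfolding eq by (rule diffops_le_add)
  qed
  then show ?case
    unfolding Suc.hyps(2)[symmetric] diffops_le_Suc_iff using clinear_map_comp[OF cl] by blast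
qed

text \<open>Scaling by \<open>u\<close> commutes with taking brackets, which reduces the claim to
  order zero, where \<open>u\<close> cancels in the domain.\<close>

lemma diffops_le_mult_cancel:
  fixes u :: "'a::idom"
  assumes "u \<noteq> 0"
  shows "clinear_map c \<theta> \<Longrightarrow> (\<lambda>x. u * \<theta> x) \<in> diffops_le c n \<Longrightarrow> \<theta> \<in> diffops_le c n"
proof (induction n arbitrary: \<theta>)
  case 0
  have "\<theta> (a * x) = a * \<theta> x" for a x
  proof -
    have "u * \<theta> (a * x) = a * (u * \<theta> x)" using 0(2) unfolding diffops_le.simps mem_Collect_eq by blast
    then have "u * \<theta> (a * x) = u * (a * \<theta> x)" by (simp only: mult.left_commute)
    with assms show ?thesis by simp
  qed
  with 0 show ?case by simp
next
  case (Suc n)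
  have cl: "clinear_map c (mult_commutator \<theta> a)" for a
    using Suc.prems(1)
    by (simp add: clinear_map_def mult_commutator_def right_diff_distrib distrib_left
        mult.left_commute[of a "c _"])
  have "(\<lambda>x. u * mult_commutator \<theta> a x) = mult_commutator (\<lambda>x. u * \<theta> x) a" for a
    by (auto simp: mult_commutator_def algebra_simps)
  then have "mult_commutator \<theta> a \<in> diffops_le c n" for a
    using Suc.IH[OF cl] mult_commutator_in_diffops_le[OF Suc.prems(2)] by simp
  with Suc.prems(1) show ?case by (simp add: diffops_le_Suc_iff del: diffops_le.simps)
qed

text \<open>Multiplication by \<open>u\<close> preserves the order of an operator while the commutator lowers it.\<close>
lemma mult_eq_mult_commutator_imp_zero:
  fixes u :: "'a::idom"
  assumes "u \<noteq> 0" and "(\<lambda>x. u * \<theta> x) = mult_commutator \<theta> a" and "\<theta> \<in> diffops c"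
  shows "\<theta> = (\<lambda>_. 0)"
proof -
  obtain n where "\<theta> \<in> diffops_le c n" using assms(3) by (auto simp: diffops_def)
  then show ?thesis
  proof (induction n)
    case 0
    then have "(\<lambda>x. u * \<theta> x) = (\<lambda>_. 0)" using assms(2) mult_commutator_order_0 by metis
    with assms(1) show ?case by (simp add: fun_eq_iff)
  next
    case (Suc n)
    with assms show ?case
      by (metis diffops_le_clinear diffops_le_mult_cancel mult_commutator_in_diffops_le)
  qed
qed

lemma diffops_clinear: "\<theta> \<in> diffops c \<Longrightarrow> clinear_map c \<theta>"
  by (auto simp: diffops_def diffops_le_clinear)

lemma mult_in_diffops: "(*) a \<in> diffops c"
  unfolding diffops_def using diffops_le_0_iff[of "(*) a" c] by blast

lemma diffops_comp: "f \<in> diffops c \<Longrightarrow> g \<in> diffops c \<Longrightarrow> f \<circ> g \<in> diffops c"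
  by (auto simp: diffops_def intro: diffops_le_comp)

lemma diffops_add: "f \<in> diffops c \<Longrightarrow> g \<in> diffops c \<Longrightarrow> (\<lambda>x. f x + g x) \<in> diffops c"
proof -
  assume "f \<in> diffops c" "g \<in> diffops c"
  then obtain m n where "f \<in> diffops_le c m" "g \<in> diffops_le c n" by (auto simp: diffops_def)
  then have "f \<in> diffops_le c (max m n)" "g \<in> diffops_le c (max m n)"
    by (auto intro: diffops_le_mono[of m] diffops_le_mono[of n] simp del: diffops_le.simps)
  then show ?thesis unfolding diffops_def using diffops_le_add by blast
qed

lemma id_eq_mult: "id = (*) (1::'a::comm_ring_1)"
  by auto

lemma mult_comp_in_diffops: "f \<in> diffops c \<Longrightarrow> (\<lambda>x. a * f x) \<in> diffops c"
  using diffops_comp[OF mult_in_diffops, of f c a] by (simp add: comp_def)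

lemma diffops_subalg_diffops: "diffops_subalg c (diffops c)"
  by (auto simp: diffops_subalg_def mult_comp_in_diffops diffops_add diffops_comp)
     (simp add: id_eq_mult mult_in_diffops)

lemma diffops_diff: "f \<in> diffops c \<Longrightarrow> g \<in> diffops c \<Longrightarrow> (\<lambda>x. f x - g x) \<in> diffops c"
  using diffops_add[of f c "\<lambda>x. - 1 * g x"] mult_comp_in_diffops[of g c "-1"] by simp

section \<open>Subalgebras and two-sided ideals of operators\<close>

locale complex_algebra =
  fixes c :: "complex \<Rightarrow> 'a::idom"
  assumes struct: "calg_struct c"
begin

lemma c_one: "c 1 = 1" and c_add: "c (z + w) = c z + c w" and c_mult: "c (z * w) = c z * c w"
  using struct by (auto simp: calg_struct_def)

lemma c_zero: "c 0 = 0"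
  by (rule additive_imp_zero[of c, OF c_add])

lemma c_uminus: "c (- z) = - c z"
  using c_add[of "-z" z] by (simp add: c_zero eq_neg_iff_add_eq_0)

lemma c_of_nat: "c (of_nat n) = of_nat n"
  by (induction n) (simp_all add: c_zero c_add c_one)

lemma of_nat_mult_inverse: "n \<noteq> 0 \<Longrightarrow> c (1 / of_nat n) * of_nat n = 1"
  by (simp flip: c_of_nat c_mult add: c_one)

lemma of_nat_nonzero: "n \<noteq> 0 \<Longrightarrow> (of_nat n :: 'a) \<noteq> 0"
  using of_nat_mult_inverse[of n] by auto

lemma of_nat_inj: "(of_nat m :: 'a) = of_nat n \<Longrightarrow> m = n"
proof (rule ccontr)
  have *: "(of_nat i :: 'a) \<noteq> of_nat j" if "i < j" for i j
    using of_nat_nonzero[of "j - i"] that by auto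
  assume "m \<noteq> n" "(of_nat m :: 'a) = of_nat n"
  with *[of m n] *[of n m] show False by (cases m n rule: linorder_cases) auto
qed

context
  fixes B assumes B: "diffops_subalg c B"
begin

lemma subalg_in_diffops: "f \<in> B \<Longrightarrow> f \<in> diffops c"
  and subalg_id: "id \<in> B"
  and subalg_add: "f \<in> B \<Longrightarrow> g \<in> B \<Longrightarrow> (\<lambda>x. f x + g x) \<in> B"
  and subalg_comp: "f \<in> B \<Longrightarrow> g \<in> B \<Longrightarrow> f \<circ> g \<in> B"
  and subalg_scale: "f \<in> B \<Longrightarrow> (\<lambda>x. c z * f x) \<in> B"
  using B by (auto simp: diffops_subalg_def)

lemma subalg_zero: "(\<lambda>_. 0) \<in> B"
  using subalg_scale[OF subalg_id, of 0] by (simp add: c_zero)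

lemma subalg_diff: "f \<in> B \<Longrightarrow> g \<in> B \<Longrightarrow> (\<lambda>x. f x - g x) \<in> B"
  using subalg_add[of f "\<lambda>x. c (- 1) * g x"] subalg_scale[of g "-1"] by (simp add: c_uminus c_one)

lemma subalg_sum: "(\<And>i. i \<in> I \<Longrightarrow> f i \<in> B) \<Longrightarrow> (\<lambda>x. \<Sum>i\<in>I. f i x) \<in> B"
  by (induction I rule: infinite_finite_induct) (simp_all add: subalg_zero subalg_add)

text \<open>The scalar \<open>1 / n\<close> comes from the complex numbers; this is what makes
  averaging over a finite group possible inside a subalgebra.\<close>

lemma subalg_of_nat_cancel:
  assumes "n \<noteq> 0" "(\<lambda>x. of_nat n * f x) \<in> B"
  shows "f \<in> B"
  using subalg_scale[OF assms(2), of "1 / of_nat n"] of_nat_mult_inverse[OF assms(1)]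
  by (simp flip: mult.assoc)

end

text \<open>The two-sided ideal generated by \<open>d\<close>, as finite sums of products. Additive
  inverses arise by absorbing a sign into \<open>a\<close>.\<close>

inductive_set op_ideal :: "('a \<Rightarrow> 'a) \<Rightarrow> ('a \<Rightarrow> 'a) set" for d where
  op_ideal_base: "a \<in> diffops c \<Longrightarrow> b \<in> diffops c \<Longrightarrow> a \<circ> d \<circ> b \<in> op_ideal d"
| op_ideal_add: "f \<in> op_ideal d \<Longrightarrow> g \<in> op_ideal d \<Longrightarrow> (\<lambda>x. f x + g x) \<in> op_ideal d"

lemma op_ideal_in_diffops: "f \<in> op_ideal d \<Longrightarrow> d \<in> diffops c \<Longrightarrow> f \<in> diffops c"
  by (induction rule: op_ideal.induct) (auto intro: diffops_comp diffops_add)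

lemma op_ideal_left: "f \<in> op_ideal d \<Longrightarrow> e \<in> diffops c \<Longrightarrow> e \<circ> f \<in> op_ideal d"
proof (induction rule: op_ideal.induct)
  case (op_ideal_base a b)
  have "e \<circ> (a \<circ> d \<circ> b) = (e \<circ> a) \<circ> d \<circ> b" by (simp only: o_assoc)
  with op_ideal_base show ?case by (simp only: op_ideal.op_ideal_base diffops_comp)
next
  case (op_ideal_add f g)
  then show ?case
    using op_ideal.op_ideal_add[of "e \<circ> f" d "e \<circ> g"]
    by (simp add: comp_def clinear_map_add[OF diffops_clinear[of e c]])
qed

lemma op_ideal_right: "f \<in> op_ideal d \<Longrightarrow> e \<in> diffops c \<Longrightarrow> f \<circ> e \<in> op_ideal d"
proof (induction rule: op_ideal.induct)
  case (op_ideal_base a b)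
  have "(a \<circ> d \<circ> b) \<circ> e = a \<circ> d \<circ> (b \<circ> e)" by (simp only: o_assoc)
  with op_ideal_base show ?case by (simp only: op_ideal.op_ideal_base diffops_comp)
next
  case (op_ideal_add f g)
  then show ?case
    using op_ideal.op_ideal_add[of "f \<circ> e" d "g \<circ> e"] by (simp add: comp_def)
qed

lemma op_ideal_eq_diffops:
  assumes "diffops_simple c" and d: "d \<in> diffops c" "d \<noteq> (\<lambda>_. 0)"
  shows "op_ideal d = diffops c"
proof -
  have id: "id \<in> diffops c" using diffops_subalg_diffops by (auto simp: diffops_subalg_def)
  have dI: "d \<in> op_ideal d" using op_ideal_base[OF id id] by simp
  have neg: "(\<lambda>x. - f x) \<in> op_ideal d" if "f \<in> op_ideal d" for f
    using op_ideal_left[OF that mult_in_diffops[of "-1"]] by (simp add: comp_def)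
  have diff: "(\<lambda>x. f x - g x) \<in> op_ideal d" if "f \<in> op_ideal d" "g \<in> op_ideal d" for f g
    using op_ideal_add[OF that(1) neg[OF that(2)]] by simp
  have "op_ideal d = {\<lambda>_. 0} \<or> op_ideal d = diffops c"
    using assms(1) unfolding diffops_simple_def
    by (rule allE[of _ "op_ideal d"])
       (use d diff[OF dI dI] in \<open>auto intro: diff op_ideal_left op_ideal_right op_ideal_in_diffops\<close>)
  with d dI show ?thesis by auto
qed

end

section \<open>Polynomials with invariant coefficients, and derivations\<close>

lemma map_poly_mult_hom:
  fixes f :: "'a::comm_ring_1 \<Rightarrow> 'b::comm_ring_1"
  assumes add: "\<And>x y. f (x + y) = f x + f y" and mult: "\<And>x y. f (x * y) = f x * f y"
  shows "map_poly f (p * q) = map_poly f p * map_poly f q"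
  using additive_imp_zero[of f, OF add]
  by (intro poly_eqI) (simp add: coeff_mult coeff_map_poly additive_imp_sum[of f, OF add] mult)

text \<open>Applied to the coefficients, the ring homomorphism \<open>f\<close> merely permutes the
  linear factors.\<close>

lemma coeff_prod_linear_invariant:
  fixes f :: "'a::idom \<Rightarrow> 'a"
  assumes add: "\<And>x y. f (x + y) = f x + f y" and mult: "\<And>x y. f (x * y) = f x * f y"
    and one: "f 1 = 1" and "bij_betw f Z Z"
  shows "f (coeff (\<Prod>z\<in>Z. [:- z, 1:]) n) = coeff (\<Prod>z\<in>Z. [:- z, 1:]) n"
proof -
  have zero: "f 0 = 0" by (rule additive_imp_zero[of f, OF add])
  have "f (- z) = - f z" for z using additive_imp_diff[of f, OF add, of 0 z] by (simp add: zero)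
  then have lin: "map_poly f [:- z, 1:] = [:- f z, 1:]" for z
    by (simp add: map_poly_pCons zero one)
  have "map_poly f (\<Prod>z\<in>A. [:- z, 1:]) = (\<Prod>z\<in>A. [:- f z, 1:])" for A
    by (induction A rule: infinite_finite_induct)
       (simp_all add: map_poly_mult_hom[of f, OF add mult] lin one zero del: mult_pCons_left)
  also have "(\<Prod>z\<in>Z. [:- f z, 1:]) = (\<Prod>z\<in>Z. [:- z, 1:])"
    by (rule prod.reindex_bij_betw[OF assms(4)])
  finally show ?thesis by (metis coeff_map_poly zero)
qed

text \<open>Synthetic division: each coefficient of \<open>q\<close> is the next higher coefficient
  of the product plus \<open>t\<close> times the next higher coefficient of
  \<open>q\<close>.\<close>

lemma coeff_linear_factor_mem:
  fixes q :: "'a::comm_ring_1 poly"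
  assumes p: "\<And>n. coeff ([:- t, 1:] * q) n \<in> P" and "t \<in> P" "0 \<in> P"
    and "\<And>x y. x \<in> P \<Longrightarrow> y \<in> P \<Longrightarrow> x + y \<in> P" "\<And>x y. x \<in> P \<Longrightarrow> y \<in> P \<Longrightarrow> x * y \<in> P"
  shows "coeff q n \<in> P"
proof -
  \<comment> \<open>The recursion descends in the index, so it starts just above the degree, where
    the coefficient is zero.\<close>
  have "coeff q (Suc (degree q) - k) \<in> P" if "k \<le> Suc (degree q)" for k
    using that
  proof (induction k)
    case 0
    show ?case using assms(3) by (simp add: coeff_eq_0)
  next
    case (Suc k)
    define n where "n = Suc (degree q) - Suc k"
    have n: "Suc n = Suc (degree q) - k" using Suc.prems by (simp add: n_def)
    have "coeff q n = coeff ([:- t, 1:] * q) (Suc n) + t * coeff q (Suc n)" by simp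
    with Suc assms show ?case by (metis n n_def Suc_leD)
  qed
  from this[of "Suc (degree q) - n"] show ?thesis
    using assms(3) by (cases "n \<le> degree q") (auto simp: coeff_eq_0 not_le)
qed

text \<open>The chain rule for a derivation that kills the coefficients, by the Leibniz rule applied
  to \<open>x\<close> times the value of the shorter polynomial.\<close>

lemma derivation_poly:
  fixes \<delta> :: "'a::idom \<Rightarrow> 'a"
  assumes add: "\<And>x y. \<delta> (x + y) = \<delta> x + \<delta> y" and mult: "\<And>x y. \<delta> (x * y) = x * \<delta> y + y * \<delta> x"
    and "\<And>n. \<delta> (coeff p n) = 0"
  shows "\<delta> (poly p x) = poly (pderiv p) x * \<delta> x"
  using assms(3)
proof (induction p)
  case 0
  then show ?case by (simp add: additive_imp_zero[of \<delta>, OF add])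
next
  case (pCons a p)
  have "\<delta> a = 0" using pCons.prems[of 0] by simp
  moreover have "\<delta> (coeff p n) = 0" for n using pCons.prems[of "Suc n"] by simp
  ultimately show ?case
    using pCons.IH by (simp add: add mult pderiv_pCons algebra_simps)
qed


section \<open>The group action on functions and operators, and traces\<close>

locale galois_action = complex_algebra c + group W
  for c :: "complex \<Rightarrow> 'a::idom" and W :: "('g, 'b) monoid_scheme" (structure) +
  fixes act :: "'g \<Rightarrow> 'a \<Rightarrow> 'a"
  assumes fin: "finite (carrier W)" and faithful: "faithful_action c W act"
begin

lemma
  assumes "g \<in> carrier W"
  shows act_add: "act g (x + y) = act g x + act g y"
    and act_mult: "act g (x * y) = act g x * act g y"
    and act_one: "act g 1 = 1"
    and act_c: "act g (c z) = c z"
    and act_bij: "bij (act g)"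
  using faithful assms by (auto simp: faithful_action_def calg_aut_def)

lemma act_act: "g \<in> carrier W \<Longrightarrow> h \<in> carrier W \<Longrightarrow> act g (act h x) = act (g \<otimes> h) x"
  using faithful by (simp add: faithful_action_def)

lemma act_eq_iff: "g \<in> carrier W \<Longrightarrow> act g x = act g y \<longleftrightarrow> x = y"
  using act_bij by (metis bij_pointE)

lemma act_id: "act \<one> x = x"
  using act_act[of \<one> \<one> x] act_eq_iff[of \<one>] by simp

lemma act_inv: "g \<in> carrier W \<Longrightarrow> act g (act (inv g) x) = x"
  and act_inv': "g \<in> carrier W \<Longrightarrow> act (inv g) (act g x) = x"
  by (simp_all add: act_act act_id)

lemmas act_zero = additive_imp_zero[of "act g" for g, OF act_add]
  and act_diff = additive_imp_diff[of "act g" for g, OF act_add]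
  and act_sum = additive_imp_sum[of "act g" for g, OF act_add]

lemma act_power: "g \<in> carrier W \<Longrightarrow> act g (x ^ n) = act g x ^ n"
  by (induction n) (simp_all add: act_one act_mult)

lemma act_faithful: "g \<in> carrier W \<Longrightarrow> (\<And>x. act g x = x) \<Longrightarrow> g = \<one>"
  using faithful act_id by (auto simp: faithful_action_def inj_on_def fun_eq_iff)

definition conjugate :: "'g \<Rightarrow> ('a \<Rightarrow> 'a) \<Rightarrow> 'a \<Rightarrow> 'a" where
  "conjugate g \<theta> = (\<lambda>x. act g (\<theta> (act (inv g) x)))"

lemma conjugate_comp: "g \<in> carrier W \<Longrightarrow> conjugate g (\<theta> \<circ> \<phi>) = conjugate g \<theta> \<circ> conjugate g \<phi>"
  by (simp add: conjugate_def fun_eq_iff act_inv')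

lemma conjugate_conj: "g \<in> carrier W \<Longrightarrow> h \<in> carrier W \<Longrightarrow> conjugate g (conjugate h \<theta>) = conjugate (g \<otimes> h) \<theta>"
  by (simp add: conjugate_def fun_eq_iff act_act inv_mult_group)

lemma conjugate_one: "conjugate \<one> \<theta> = \<theta>"
  by (simp add: conjugate_def act_id)

lemma conjugate_mult: "g \<in> carrier W \<Longrightarrow> conjugate g ((*) a) = (*) (act g a)"
  by (simp add: conjugate_def fun_eq_iff act_mult act_inv)

lemma conjugate_add: "g \<in> carrier W \<Longrightarrow> conjugate g (\<lambda>x. \<theta> x + \<phi> x) = (\<lambda>x. conjugate g \<theta> x + conjugate g \<phi> x)"
  by (simp add: conjugate_def fun_eq_iff act_add)

lemma conjugate_sum: "g \<in> carrier W \<Longrightarrow> conjugate g (\<lambda>x. \<Sum>i\<in>A. \<theta> i x) = (\<lambda>x. \<Sum>i\<in>A. conjugate g (\<theta> i) x)"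
  by (simp add: conjugate_def fun_eq_iff act_sum)

lemma conjugate_id: "g \<in> carrier W \<Longrightarrow> conjugate g id = id"
  by (simp add: conjugate_def fun_eq_iff act_inv)

lemma conjugate_mult_commutator:
  "g \<in> carrier W \<Longrightarrow> mult_commutator (conjugate g \<theta>) a = conjugate g (mult_commutator \<theta> (act (inv g) a))"
  by (simp add: conjugate_def mult_commutator_def fun_eq_iff act_mult act_diff act_inv)

lemma conjugate_clinear: "g \<in> carrier W \<Longrightarrow> clinear_map c \<theta> \<Longrightarrow> clinear_map c (conjugate g \<theta>)"
  by (simp add: clinear_map_def conjugate_def act_add act_mult act_c)

lemma conjugate_diffops_le: "g \<in> carrier W \<Longrightarrow> \<theta> \<in> diffops_le c n \<Longrightarrow> conjugate g \<theta> \<in> diffops_le c n"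
proof (induction n arbitrary: \<theta>)
  case 0
  then show ?case unfolding diffops_le_0_iff by (auto simp: conjugate_mult)
next
  case (Suc n)
  then show ?case by (simp add: diffops_le_Suc_iff conjugate_clinear conjugate_mult_commutator del: diffops_le.simps)
qed

lemma conjugate_diffops: "g \<in> carrier W \<Longrightarrow> \<theta> \<in> diffops c \<Longrightarrow> conjugate g \<theta> \<in> diffops c"
  using conjugate_diffops_le by (auto simp: diffops_def simp del: diffops_le.simps)

lemma diffops_inv_iff:
  "\<theta> \<in> diffops_inv c W act H \<longleftrightarrow> \<theta> \<in> diffops c \<and> (\<forall>h\<in>H. conjugate h \<theta> = \<theta>)"
  by (simp add: diffops_inv_def conjugate_def comp_def)

lemma diffops_inv_subalg:
  assumes "H \<subseteq> carrier W"
  shows "diffops_subalg c (diffops_inv c W act H)"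
proof -
  have "(*) (c z) \<in> diffops_inv c W act H" for z
    using assms by (auto simp: diffops_inv_iff mult_in_diffops conjugate_mult act_c)
  moreover have comp: "f \<circ> g \<in> diffops_inv c W act H"
    if "f \<in> diffops_inv c W act H" "g \<in> diffops_inv c W act H" for f g
    using that assms by (auto simp: diffops_inv_iff diffops_comp conjugate_comp subset_iff)
  ultimately have "(\<lambda>x. c z * f x) \<in> diffops_inv c W act H"
    if "f \<in> diffops_inv c W act H" for f z
    using that comp[of "(*) (c z)" f] by (simp add: comp_def)
  moreover have "id \<in> diffops_inv c W act H"
    using assms diffops_subalg_diffops[of c]
    by (auto simp: diffops_inv_iff conjugate_id diffops_subalg_def subset_iff)
  moreover have "(\<lambda>x. f x + g x) \<in> diffops_inv c W act H"
    if "f \<in> diffops_inv c W act H" "g \<in> diffops_inv c W act H" for f g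
    using that assms by (auto simp: diffops_inv_iff diffops_add conjugate_add subset_iff)
  ultimately show ?thesis
    using comp by (auto simp: diffops_subalg_def diffops_inv_iff)
qed

text \<open>An unnormalised Reynolds operator: on operators invariant under a finite
  \<open>H\<close> it is multiplication by \<open>card H\<close>.\<close>

definition trace :: "'g set \<Rightarrow> ('a \<Rightarrow> 'a) \<Rightarrow> 'a \<Rightarrow> 'a" where
  "trace H \<theta> = (\<lambda>x. \<Sum>h\<in>H. conjugate h \<theta> x)"

text \<open>Conjugation by an element of \<open>H\<close> permutes the summands by left
  translation.\<close>

lemma trace_in_diffops_inv:
  assumes H: "subgroup H W" and \<theta>: "\<theta> \<in> diffops c"
  shows "trace H \<theta> \<in> diffops_inv c W act H"
proof -
  have sub: "H \<subseteq> carrier W" by (rule subgroup.subset[OF H])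
  have "conjugate g (trace H \<theta>) = trace H \<theta>" if g: "g \<in> H" for g
  proof -
    have gc: "g \<in> carrier W" using g sub by blast
    have "bij_betw (\<lambda>h. g \<otimes> h) H H"
    proof (rule bij_betw_byWitness[where f' = "\<lambda>h. inv g \<otimes> h"])
      show "\<forall>a\<in>H. inv g \<otimes> (g \<otimes> a) = a" "\<forall>a\<in>H. g \<otimes> (inv g \<otimes> a) = a"
        using gc sub by (auto simp: m_assoc[symmetric])
    qed (use H g in \<open>auto intro: subgroup.m_closed subgroup.m_inv_closed\<close>)
    then have "(\<Sum>h\<in>H. conjugate (g \<otimes> h) \<theta> x) = (\<Sum>h\<in>H. conjugate h \<theta> x)" for x
      by (rule sum.reindex_bij_betw)
    moreover have "conjugate g (conjugate h \<theta>) = conjugate (g \<otimes> h) \<theta>" if "h \<in> H" for h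
      using that sub gc by (auto intro: conjugate_conj)
    ultimately show ?thesis
      by (simp add: trace_def conjugate_sum[OF gc] cong: sum.cong)
  qed
  moreover have "trace H \<theta> \<in> diffops c"
    unfolding trace_def using sub \<theta>
    by (intro subalg_sum[OF diffops_subalg_diffops]) (auto intro: conjugate_diffops)
  ultimately show ?thesis by (simp add: diffops_inv_iff)
qed

section \<open>Generic elements and operators commuting with the invariants\<close>

text \<open>A complex vector space is not a finite union of proper subspaces.\<close>
lemma exists_generic_element:
  assumes "finite N" "N \<subseteq> carrier W" "0 \<in> P"
    and add: "\<And>x y. x \<in> P \<Longrightarrow> y \<in> P \<Longrightarrow> x + y \<in> P"
    and scale: "\<And>z x. x \<in> P \<Longrightarrow> c z * x \<in> P"
    and moved: "\<And>g. g \<in> N \<Longrightarrow> \<exists>y\<in>P. act g y \<noteq> y"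
  shows "\<exists>\<theta>\<in>P. \<forall>g\<in>N. act g \<theta> \<noteq> \<theta>"
  using assms(1,2) moved
proof (induction N)
  case empty
  with assms(3) show ?case by auto
next
  case (insert g N)
  from insert obtain \<theta> where \<theta>: "\<theta> \<in> P" "\<forall>h\<in>N. act h \<theta> \<noteq> \<theta>" by auto
  from insert.prems obtain y where y: "y \<in> P" "act g y \<noteq> y" by auto
  show ?case
  proof (cases "act g \<theta> = \<theta>")
    case False
    with \<theta> show ?thesis by auto
  next
    case True
    \<comment> \<open>Candidates are the points \<open>y + n \<theta>\<close>. Each \<open>h\<close>
      in \<open>N\<close> moves \<open>\<theta>\<close> and so fixes at most one of them;
      \<open>g\<close> fixes \<open>\<theta>\<close> but moves \<open>y\<close> and so fixes
      none.\<close>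
    define bad where "bad h = {n::nat. act h (y + c (of_nat n) * \<theta>) = y + c (of_nat n) * \<theta>}" for h
    have bad: "finite (bad h)" if h: "h \<in> N" for h
    proof -
      have "m = n" if mn: "m \<in> bad h" "n \<in> bad h" for m n
      proof -
        have hc: "h \<in> carrier W" using h insert.prems by auto
        have "act h y - y = of_nat k * (\<theta> - act h \<theta>)" if "k \<in> bad h" for k
          using that hc act_c[OF hc, of "of_nat k"]
          by (simp add: bad_def act_add act_mult c_of_nat algebra_simps)
        from this[OF mn(1)] this[OF mn(2)]
        have "of_nat m * (\<theta> - act h \<theta>) = of_nat n * (\<theta> - act h \<theta>)" by (rule trans[OF sym])
        moreover have "\<theta> - act h \<theta> \<noteq> 0" using \<theta>(2) h by auto
        ultimately show ?thesis by (metis mult_cancel_right of_nat_inj)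
      qed
      then have "bad h = {} \<or> (\<exists>n. bad h = {n})" by blast
      then show ?thesis by auto
    qed
    then have "finite (\<Union>h\<in>N. bad h)" using insert.hyps by auto
    then obtain n where n: "n \<notin> (\<Union>h\<in>N. bad h)" using ex_new_if_finite[of "\<Union>h\<in>N. bad h"] by auto
    have "act g (y + c (of_nat n) * \<theta>) \<noteq> y + c (of_nat n) * \<theta>"
      using y True insert.prems(1) by (simp add: act_add act_mult act_c)
    moreover have "y + c (of_nat n) * \<theta> \<in> P" using y \<theta> add scale by simp
    ultimately show ?thesis using n by (intro bexI[of _ "y + c (of_nat n) * \<theta>"]) (auto simp: bad_def)
  qed
qed

text \<open>The quotient of the separable minimal polynomial of \<open>\<theta>\<close> by \<open>X - \<theta>\<close>.\<close>
lemma exists_separating_polynomial: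
  obtains q where "poly q \<theta> \<noteq> 0"
    and "\<And>g. g \<in> carrier W \<Longrightarrow> act g \<theta> \<noteq> \<theta> \<Longrightarrow> poly q (act g \<theta>) = 0"
    and "\<And>g n. g \<in> carrier W \<Longrightarrow> act g (coeff ([:- \<theta>, 1:] * q) n) = coeff ([:- \<theta>, 1:] * q) n"
proof -
  \<comment> \<open>The orbit is a set, so a nontrivial stabiliser of \<open>\<theta>\<close>
    produces no repeated factor and \<open>q\<close> does not vanish at
    \<open>\<theta>\<close>.\<close>
  define Z where "Z = (\<lambda>h. act h \<theta>) ` carrier W"
  define q where "q = (\<Prod>z\<in>Z - {\<theta>}. [:- z, 1:])"
  have finZ: "finite Z" by (simp add: Z_def fin)
  have "\<theta> \<in> Z" using act_id[of \<theta>] by (force simp: Z_def)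
  then have p: "[:- \<theta>, 1:] * q = (\<Prod>z\<in>Z. [:- z, 1:])"
    unfolding q_def by (rule prod.remove[OF finZ, symmetric])
  show thesis
  proof (rule that)
    show "poly q \<theta> \<noteq> 0" using finZ by (auto simp: q_def poly_prod)
    show "poly q (act g \<theta>) = 0" if "g \<in> carrier W" "act g \<theta> \<noteq> \<theta>" for g
      using that finZ by (auto simp: q_def poly_prod Z_def)
    show "act g (coeff ([:- \<theta>, 1:] * q) n) = coeff ([:- \<theta>, 1:] * q) n" if g: "g \<in> carrier W" for g n
    proof -
      have "act g ` Z \<subseteq> Z" using g by (auto simp: Z_def act_act)
      moreover have inj: "inj_on (act g) Z" using g by (simp add: inj_on_def act_eq_iff)
      ultimately have "bij_betw (act g) Z Z" using finZ by (simp add: bij_betw_def endo_inj_surj)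
      then show ?thesis unfolding p using g
        by (intro coeff_prod_linear_invariant) (auto simp: act_add act_mult act_one)
    qed
  qed
qed

text \<open>Such an operator has order zero because a derivation vanishing on the invariants vanishes
  on every element algebraic over them.\<close>
lemma commutes_with_invariants_imp_order_0:
  assumes "s \<in> diffops c"
    and "\<And>f. (\<And>g. g \<in> carrier W \<Longrightarrow> act g f = f) \<Longrightarrow> mult_commutator s f = (\<lambda>_. 0)"
  shows "s \<in> diffops_le c 0"
proof -
  obtain n where "s \<in> diffops_le c n" using assms(1) by (auto simp: diffops_def)
  then show ?thesis using assms(2)
  proof (induction n arbitrary: s)
    case 0
    then show ?case by blast
  next
    case (Suc n)
    note cl = diffops_le_clinear[OF Suc.prems(1)]
    define \<delta> where "\<delta> x = mult_commutator s x 1" for x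
    have comm: "mult_commutator s x = (*) (\<delta> x)" for x
    proof -
      \<comment> \<open>An invariant \<open>f\<close> commutes with \<open>s\<close> and with
        multiplication by \<open>x\<close>, hence with their bracket. The induction hypothesis then
        makes that bracket a multiplication operator.\<close>
      have "mult_commutator (mult_commutator s x) f = (\<lambda>_. 0)"
        if "\<And>g. g \<in> carrier W \<Longrightarrow> act g f = f" for f
      proof -
        have "s (f * y) = f * s y" for y
          using Suc.prems(2)[OF that] by (simp add: mult_commutator_def fun_eq_iff)
        then have "s (x * (f * y)) = f * s (x * y)" for y
          by (simp only: mult.left_commute[of x f])
        with \<open>\<And>y. s (f * y) = f * s y\<close> show ?thesis
          by (simp add: mult_commutator_def fun_eq_iff right_diff_distrib mult.left_commute)
      qed
      from Suc.IH[OF mult_commutator_in_diffops_le[OF Suc.prems(1)] this]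
      obtain a where "mult_commutator s x = (*) a" unfolding diffops_le_0_iff by blast
      then show ?thesis by (simp add: \<delta>_def)
    qed
    have add: "\<delta> (x + y) = \<delta> x + \<delta> y" for x y
      by (simp add: \<delta>_def mult_commutator_def clinear_map_add[OF cl] algebra_simps)
    have mult: "\<delta> (x * y) = x * \<delta> y + y * \<delta> x" for x y
    proof -
      have "\<delta> (x * y) = mult_commutator s x y + x * mult_commutator s y 1"
        by (simp add: \<delta>_def mult_commutator_def algebra_simps)
      then show ?thesis unfolding comm by (simp add: algebra_simps)
    qed
    have "\<delta> x = 0" for x
    proof -
      obtain q where q: "poly q x \<noteq> 0"
        and inv: "\<And>g n. g \<in> carrier W \<Longrightarrow> act g (coeff ([:- x, 1:] * q) n) = coeff ([:- x, 1:] * q) n"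
        by (rule exists_separating_polynomial[of x]) (rule that)
      \<comment> \<open>The coefficients are invariant, so \<open>\<delta>\<close> kills them. As
        \<open>x\<close> is a root at which the derivative takes the nonzero value
        \<open>poly q x\<close>, the chain rule forces \<open>\<delta> x = 0\<close>.\<close>
      have "\<delta> (coeff ([:- x, 1:] * q) n) = 0" for n
        unfolding \<delta>_def by (subst Suc.prems(2)) (use inv in \<open>blast, simp\<close>)
      then have "\<delta> (poly ([:- x, 1:] * q) x) = poly (pderiv ([:- x, 1:] * q)) x * \<delta> x"
        by (rule derivation_poly[of \<delta>, OF add mult])
      moreover have "poly ([:- x, 1:] * q) x = 0" by simp
      moreover have "poly (pderiv ([:- x, 1:] * q)) x = poly q x"
        unfolding pderiv_mult by (simp add: pderiv_pCons)
      ultimately show ?thesis using q additive_imp_zero[of \<delta>, OF add] by simp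
    qed
    then have "s (x * y) = x * s y" for x y
      using comm[of x] by (simp add: mult_commutator_def fun_eq_iff)
    with cl show ?case by simp
  qed
qed

section \<open>The twisted bimodule and outer automorphisms\<close>

text \<open>The sub-bimodule generated by \<open>(F, \<dots>, F)\<close> in the sum over \<open>k \<in> W\<close> of copies of the
  ring of differential operators, the right action on the \<open>k\<close>-th copy being twisted by \<open>k\<close>.\<close>
inductive_set bimod :: "('a \<Rightarrow> 'a) \<Rightarrow> ('g \<Rightarrow> 'a \<Rightarrow> 'a) set" for F where
  bimod_base: "(\<lambda>_. F) \<in> bimod F"
| bimod_left: "m \<in> bimod F \<Longrightarrow> d \<in> diffops c \<Longrightarrow> (\<lambda>k. d \<circ> m k) \<in> bimod F"
| bimod_right: "m \<in> bimod F \<Longrightarrow> d \<in> diffops c \<Longrightarrow> (\<lambda>k. m k \<circ> conjugate k d) \<in> bimod F"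
| bimod_add: "m \<in> bimod F \<Longrightarrow> m' \<in> bimod F \<Longrightarrow> (\<lambda>k x. m k x + m' k x) \<in> bimod F"

lemma bimod_diff:
  assumes "m \<in> bimod F" "m' \<in> bimod F"
  shows "(\<lambda>k x. m k x - m' k x) \<in> bimod F"
  using bimod_add[OF assms(1) bimod_left[OF assms(2) mult_in_diffops[of "-1"]]] by simp

lemma bimod_in_diffops: "m \<in> bimod F \<Longrightarrow> F \<in> diffops c \<Longrightarrow> k \<in> carrier W \<Longrightarrow> m k \<in> diffops c"
  by (induction rule: bimod.induct) (auto intro: diffops_comp diffops_add conjugate_diffops)

text \<open>Multiplying the whole family on both sides and adding reaches every element of the ideal
  generated by one component, while zero components stay zero.\<close>

lemma bimod_replace_component:
  assumes m: "m \<in> bimod F" "F \<in> diffops c" and j: "j \<in> carrier W" and "e \<in> op_ideal (m j)"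
  shows "\<exists>m'\<in>bimod F. m' j = e \<and> (\<forall>k\<in>carrier W. m k = (\<lambda>_. 0) \<longrightarrow> m' k = (\<lambda>_. 0))"
  using assms(4)
proof (induction rule: op_ideal.induct)
  case (op_ideal_base a b)
  \<comment> \<open>Conjugating \<open>b\<close> by \<open>inv j\<close> beforehand cancels the
    twist of the right action in component \<open>j\<close>.\<close>
  define m' where "m' = (\<lambda>k. a \<circ> m k \<circ> conjugate k (conjugate (inv j) b))"
  have "m' \<in> bimod F"
    unfolding m'_def using op_ideal_base j m
    by (intro bimod_right bimod_left) (auto intro: conjugate_diffops)
  moreover have "m' j = a \<circ> m j \<circ> b"
    using j by (simp add: m'_def conjugate_conj conjugate_one)
  moreover have "m' k = (\<lambda>_. 0)" if "m k = (\<lambda>_. 0)" for k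
    using that clinear_map_zero[OF diffops_clinear[OF op_ideal_base(1)]]
    by (simp add: m'_def comp_def)
  ultimately show ?case by blast
next
  case (op_ideal_add f g)
  then obtain m1 m2 where "m1 \<in> bimod F" "m1 j = f" "m2 \<in> bimod F" "m2 j = g"
    "\<forall>k\<in>carrier W. m k = (\<lambda>_. 0) \<longrightarrow> m1 k = (\<lambda>_. 0)"
    "\<forall>k\<in>carrier W. m k = (\<lambda>_. 0) \<longrightarrow> m2 k = (\<lambda>_. 0)" by auto
  then show ?case by (intro bexI[OF _ bimod_add[of m1 F m2]]) auto
qed

text \<open>The summands are simple and pairwise non-isomorphic, so the sub-bimodule contains each summand
  on which it projects nontrivially. The induction removes one twisted component at a time.\<close>
lemma bimod_contains_unit:
  assumes simple: "diffops_simple c" and F: "F \<in> diffops c" and H: "subgroup H W"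
  shows "m \<in> bimod F \<Longrightarrow> m \<one> \<noteq> (\<lambda>_. 0) \<Longrightarrow>
    \<exists>m'\<in>bimod F. m' \<one> = id \<and> (\<forall>k\<in>H - {\<one>}. m' k = (\<lambda>_. 0))"
proof (induction "card {k\<in>H. m k \<noteq> (\<lambda>_. 0)}" arbitrary: m rule: less_induct)
  case less
  have sub: "H \<subseteq> carrier W" by (rule subgroup.subset[OF H])
  have finH: "finite H" using sub fin by (rule finite_subset)
  have ideal: "op_ideal d = diffops c" if "d \<in> diffops c" "d \<noteq> (\<lambda>_. 0)" for d
    using op_ideal_eq_diffops[OF simple that] .
  \<comment> \<open>Simplicity allows the component at \<open>\<one>\<close> to be normalised to
    \<open>id\<close>.\<close>
  have "id \<in> op_ideal (m \<one>)"
    using ideal[OF bimod_in_diffops[OF less.prems(1) F]] less.prems(2) subalg_id[OF diffops_subalg_diffops]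
    by auto
  from bimod_replace_component[OF less.prems(1) F _ this]
  obtain m1 where m1: "m1 \<in> bimod F" "m1 \<one> = id"
    "\<And>k. k \<in> carrier W \<Longrightarrow> m k = (\<lambda>_. 0) \<Longrightarrow> m1 k = (\<lambda>_. 0)" by blast
  show ?case
  proof (cases "\<forall>k\<in>H - {\<one>}. m1 k = (\<lambda>_. 0)")
    case True
    with m1 show ?thesis by blast
  next
    case False
    then obtain k where k: "k \<in> H" "k \<noteq> \<one>" "m1 k \<noteq> (\<lambda>_. 0)" by auto
    have kc: "k \<in> carrier W" using k sub by blast
    obtain b where b: "act k b \<noteq> b" using act_faithful[OF kc] k(2) by blast
    \<comment> \<open>The difference of the left and the twisted right action of \<open>b\<close>
      kills the component \<open>id\<close> at \<open>\<one>\<close>, where there is no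
      twist.\<close>
    define m2 where "m2 = (\<lambda>j x. ((*) b \<circ> m1 j) x - (m1 j \<circ> conjugate j ((*) b)) x)"
    have m2: "m2 \<in> bimod F"
      unfolding m2_def using m1(1) by (intro bimod_diff bimod_left bimod_right mult_in_diffops)
    have m2_one: "m2 \<one> = (\<lambda>_. 0)" by (simp add: m2_def m1(2) conjugate_one)
    have m2_zero: "m2 j = (\<lambda>_. 0)" if "m1 j = (\<lambda>_. 0)" for j using that by (simp add: m2_def)
    have m1k: "m1 k \<in> diffops c" by (rule bimod_in_diffops[OF m1(1) F kc])
    \<comment> \<open>If this component vanished, a nonzero multiple of \<open>m1 k\<close> would be
      a bracket of \<open>m1 k\<close>, which the order forbids.\<close>
    have "m2 k \<noteq> (\<lambda>_. 0)"
    proof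
      assume "m2 k = (\<lambda>_. 0)"
      then have "(\<lambda>x. (b - act k b) * m1 k x) = mult_commutator (m1 k) (act k b)"
        by (simp add: m2_def conjugate_mult[OF kc] fun_eq_iff mult_commutator_def left_diff_distrib)
      from mult_eq_mult_commutator_imp_zero[OF _ this m1k] b k(3) show False by auto
    qed
    \<comment> \<open>By simplicity \<open>m1 k\<close> can be rebuilt at \<open>k\<close> from
      \<open>m2\<close>. Subtracting the result clears component \<open>k\<close>, leaves
      \<open>id\<close> at \<open>\<one>\<close>, and creates no new nonzero component.\<close>
    then have "m1 k \<in> op_ideal (m2 k)" using ideal[OF bimod_in_diffops[OF m2 F kc]] m1k by simp
    from bimod_replace_component[OF m2 F kc this]
    obtain m3 where m3: "m3 \<in> bimod F" "m3 k = m1 k"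
      "\<And>j. j \<in> carrier W \<Longrightarrow> m2 j = (\<lambda>_. 0) \<Longrightarrow> m3 j = (\<lambda>_. 0)" by auto
    define m4 where "m4 = (\<lambda>j x. m1 j x - m3 j x)"
    have m4: "m4 \<in> bimod F" unfolding m4_def by (rule bimod_diff[OF m1(1) m3(1)])
    have "m4 \<one> = id" using m3(3)[OF _ m2_one] by (simp add: m4_def m1(2) id_def)
    moreover have "(id :: 'a \<Rightarrow> 'a) \<noteq> (\<lambda>_. 0)" by (metis id_apply zero_neq_one)
    moreover have "{j\<in>H. m4 j \<noteq> (\<lambda>_. 0)} \<subset> {j\<in>H. m j \<noteq> (\<lambda>_. 0)}"
    proof (rule psubsetI)
      show "{j\<in>H. m4 j \<noteq> (\<lambda>_. 0)} \<subseteq> {j\<in>H. m j \<noteq> (\<lambda>_. 0)}"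
      proof safe
        fix j assume j: "j \<in> H" "m4 j \<noteq> (\<lambda>_. 0)" "m j = (\<lambda>_. 0)"
        then have "m1 j = (\<lambda>_. 0)" "m3 j = (\<lambda>_. 0)" using sub m1(3) m2_zero m3(3) by auto
        with j(2) show False by (simp add: m4_def)
      qed
      have "m4 k = (\<lambda>_. 0)" by (simp add: m4_def m3(2))
      moreover have "m k \<noteq> (\<lambda>_. 0)" using k(3) m1(3)[OF kc] by blast
      ultimately show "{j\<in>H. m4 j \<noteq> (\<lambda>_. 0)} \<noteq> {j\<in>H. m j \<noteq> (\<lambda>_. 0)}" using k(1) by blast
    qed
    ultimately show ?thesis
      using less.hyps[OF _ m4] psubset_card_mono[of "{j\<in>H. m j \<noteq> (\<lambda>_. 0)}"] finH by auto
  qed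
qed


section \<open>From traces over the group to the invariants of a subgroup\<close>

text \<open>Swapping the sums collects the coefficients into the value of \<open>q\<close> at
  \<open>act g \<theta>\<close>. This removes the terms outside \<open>H\<close>, and those inside
  agree because \<open>t\<close> is invariant under \<open>H\<close>. In the second identity the
  values of \<open>q\<close> act on the argument instead.\<close>

lemma
  assumes H: "H \<subseteq> carrier W" and t: "t \<in> diffops_inv c W act H"
    and q: "\<And>g. g \<in> carrier W \<Longrightarrow> poly q (act g \<theta>) = (if g \<in> H then f else 0)"
  shows sum_coeff_trace:
      "(\<Sum>i\<le>degree q. coeff q i * trace (carrier W) (\<lambda>x. \<theta> ^ i * t x) x) = of_nat (card H) * (f * t x)"
    and sum_trace_coeff:
      "(\<Sum>i\<le>degree q. trace (carrier W) (\<lambda>x. t (\<theta> ^ i * x)) (coeff q i * x)) = of_nat (card H) * t (f * x)"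
proof -
  have cl: "clinear_map c (conjugate g t)" if "g \<in> carrier W" for g
    using t that by (auto simp: diffops_inv_iff intro: conjugate_clinear diffops_clinear)
  have collapse: "(\<Sum>g\<in>carrier W. if g \<in> H then y else 0) = of_nat (card H) * y" for y :: 'a
    using H by (simp add: sum.inter_restrict[symmetric] fin Int_absorb1)
  have "(\<Sum>i\<le>degree q. coeff q i * trace (carrier W) (\<lambda>x. \<theta> ^ i * t x) x) =
      (\<Sum>i\<le>degree q. \<Sum>g\<in>carrier W. coeff q i * act g \<theta> ^ i * conjugate g t x)"
    by (simp add: trace_def conjugate_def act_mult act_power sum_distrib_left mult.assoc)
  also have "\<dots> = (\<Sum>g\<in>carrier W. poly q (act g \<theta>) * conjugate g t x)"
    by (subst sum.swap) (simp add: poly_altdef sum_distrib_right)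
  also have "\<dots> = (\<Sum>g\<in>carrier W. if g \<in> H then f * t x else 0)"
    using t by (intro sum.cong) (auto simp: q diffops_inv_iff)
  finally show "(\<Sum>i\<le>degree q. coeff q i * trace (carrier W) (\<lambda>x. \<theta> ^ i * t x) x) =
      of_nat (card H) * (f * t x)" by (simp only: collapse)
  have "(\<Sum>i\<le>degree q. trace (carrier W) (\<lambda>x. t (\<theta> ^ i * x)) (coeff q i * x)) =
      (\<Sum>i\<le>degree q. \<Sum>g\<in>carrier W. conjugate g t (coeff q i * act g \<theta> ^ i * x))"
    by (simp add: trace_def conjugate_def act_mult act_power act_inv' mult_ac)
  also have "\<dots> = (\<Sum>g\<in>carrier W. conjugate g t (poly q (act g \<theta>) * x))"
    by (subst sum.swap) (simp add: poly_altdef sum_distrib_right clinear_map_sum[OF cl])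
  also have "\<dots> = (\<Sum>g\<in>carrier W. if g \<in> H then t (f * x) else 0)"
    using t clinear_map_zero[OF cl] by (intro sum.cong) (auto simp: q diffops_inv_iff)
  finally show "(\<Sum>i\<le>degree q. trace (carrier W) (\<lambda>x. t (\<theta> ^ i * x)) (coeff q i * x)) =
      of_nat (card H) * t (f * x)" by (simp only: collapse)
qed

lemma trace_add: "H \<subseteq> carrier W \<Longrightarrow>
    trace H (\<lambda>x. \<theta> x + \<phi> x) = (\<lambda>x. trace H \<theta> x + trace H \<phi> x)"
  by (auto simp: trace_def conjugate_add subset_iff sum.distrib[symmetric] intro!: sum.cong)

lemma trace_bimodule:
  assumes "H \<subseteq> carrier W" "\<psi> \<in> diffops_inv c W act H"
  shows "trace H (\<theta> \<circ> \<psi>) = trace H \<theta> \<circ> \<psi>"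
  using assms by (auto simp: trace_def fun_eq_iff conjugate_comp subset_iff diffops_inv_iff intro!: sum.cong)

text \<open>Since \<open>T = diffops_inv H\<close> satisfies \<open>T f\<^sup>2 T \<subseteq> S\<close>, it remains to write \<open>1\<close> as an
  element of \<open>T f\<^sup>2 T\<close>, which is a trace of an element of the bimodule.\<close>
lemma diffops_inv_subset_of_conductor:
  assumes simple: "diffops_simple c" and S: "diffops_subalg c S" and H: "subgroup H W"
    and f: "f \<noteq> 0" "\<And>h. h \<in> H \<Longrightarrow> act h f = f"
    and left: "\<And>t. t \<in> diffops_inv c W act H \<Longrightarrow> (\<lambda>x. f * t x) \<in> S"
    and right: "\<And>t. t \<in> diffops_inv c W act H \<Longrightarrow> (\<lambda>x. t (f * x)) \<in> S"
  shows "diffops_inv c W act H \<subseteq> S"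
proof
  fix t assume t: "t \<in> diffops_inv c W act H"
  define F where "F = (*) (f * f)"
  have sub: "H \<subseteq> carrier W" by (rule subgroup.subset[OF H])
  have oneH: "\<one> \<in> H" by (rule subgroup.one_closed[OF H])
  have finH: "finite H" using sub fin by (rule finite_subset)
  have T: "diffops_subalg c (diffops_inv c W act H)" by (rule diffops_inv_subalg[OF sub])
  have F: "F \<in> diffops c" by (simp add: F_def mult_in_diffops)
  have FT: "F \<in> diffops_inv c W act H"
    using sub f F by (auto simp: diffops_inv_iff F_def conjugate_mult act_mult subset_iff)
  \<comment> \<open>\<open>\<Phi>\<close> turns the bimodule into operators. The generator goes to
    an element of \<open>T f^2 T\<close>, with \<open>T\<close> the invariants of \<open>H\<close>,
    and a family equal to \<open>id\<close> at \<open>\<one>\<close> and zero elsewhere on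
    \<open>H\<close> goes, for \<open>a\<close> and \<open>b\<close> the identity, to the scalar
    \<open>card H\<close>.\<close>
  define \<Phi> where "\<Phi> m a b = trace H (\<lambda>x. \<Sum>k\<in>H. (a \<circ> m k \<circ> conjugate k b) x)"
    for m :: "'g \<Rightarrow> 'a \<Rightarrow> 'a" and a b :: "'a \<Rightarrow> 'a"
  have \<Phi>: "\<Phi> m a b \<circ> t \<in> S" if "m \<in> bimod F" "a \<in> diffops c" "b \<in> diffops c" for m a b
    using that
  proof (induction arbitrary: a b rule: bimod.induct)
    case bimod_base
    have trb: "trace H b \<in> diffops_inv c W act H"
      by (rule trace_in_diffops_inv[OF H bimod_base(2)])
    have "(\<lambda>x. \<Sum>k\<in>H. (a \<circ> F \<circ> conjugate k b) x) = a \<circ> (F \<circ> trace H b)"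
      by (simp add: trace_def fun_eq_iff clinear_map_sum[OF diffops_clinear[OF bimod_base(1)]]
          clinear_map_sum[OF diffops_clinear[OF F]])
    then have "\<Phi> (\<lambda>_. F) a b = trace H (a \<circ> (F \<circ> trace H b))" by (simp only: \<Phi>_def)
    also have "\<dots> = trace H a \<circ> (F \<circ> trace H b)"
      by (rule trace_bimodule[OF sub subalg_comp[OF T FT trb]])
    \<comment> \<open>One factor \<open>f\<close> of \<open>F\<close> goes to each trace, so that
      \<open>right\<close> and \<open>left\<close> each apply to one half.\<close>
    finally have "\<Phi> (\<lambda>_. F) a b \<circ> t = (\<lambda>x. trace H a (f * x)) \<circ> (\<lambda>x. f * (trace H b \<circ> t) x)"
      by (simp add: F_def fun_eq_iff mult.assoc)
    moreover have "(\<lambda>x. trace H a (f * x)) \<in> S"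
      by (rule right[OF trace_in_diffops_inv[OF H bimod_base(1)]])
    moreover have "(\<lambda>x. f * (trace H b \<circ> t) x) \<in> S"
      by (rule left[OF subalg_comp[OF T trb t]])
    ultimately show ?case by (simp only: subalg_comp[OF S])
  next
    case (bimod_left m d)
    \<comment> \<open>The actions on the bimodule are absorbed into \<open>a\<close> and
      \<open>b\<close>, which is why these vary in the induction.\<close>
    have "\<Phi> (\<lambda>k. d \<circ> m k) a b = \<Phi> m (a \<circ> d) b" by (simp add: \<Phi>_def)
    with bimod_left show ?case by (simp only: diffops_comp)
  next
    case (bimod_right m d)
    have "\<Phi> (\<lambda>k. m k \<circ> conjugate k d) a b = \<Phi> m a (d \<circ> b)"
      unfolding \<Phi>_def using sub
      by (intro arg_cong[of _ _ "trace H"] ext sum.cong) (auto simp: conjugate_comp subset_iff)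
    with bimod_right show ?case by (simp only: diffops_comp)
  next
    case (bimod_add m m')
    have "\<Phi> (\<lambda>k x. m k x + m' k x) a b = (\<lambda>x. \<Phi> m a b x + \<Phi> m' a b x)"
      unfolding \<Phi>_def trace_add[OF sub, symmetric]
      by (simp add: clinear_map_add[OF diffops_clinear[OF bimod_add.prems(1)]] sum.distrib)
    with bimod_add show ?case using subalg_add[OF S, of "\<Phi> m a b \<circ> t" "\<Phi> m' a b \<circ> t"]
      by (simp add: comp_def)
  qed
  have "F \<noteq> (\<lambda>_. 0)" using f(1) by (auto simp: F_def fun_eq_iff intro!: exI[of _ 1])
  from bimod_contains_unit[OF simple F H bimod_base this]
  obtain m where m: "m \<in> bimod F" "m \<one> = id" "\<And>k. k \<in> H - {\<one>} \<Longrightarrow> m k = (\<lambda>_. 0)" by auto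
  have id: "id \<in> diffops c" by (rule subalg_id[OF diffops_subalg_diffops])
  have "(\<Sum>k\<in>H. (id \<circ> m k \<circ> conjugate k id) x) = x" for x
  proof -
    have "(\<Sum>k\<in>H. (id \<circ> m k \<circ> conjugate k id) x) = (\<Sum>k\<in>H. m k x)"
      using sub by (intro sum.cong) (auto simp: conjugate_id subset_iff)
    also have "\<dots> = m \<one> x + (\<Sum>k\<in>H - {\<one>}. m k x)" by (rule sum.remove[OF finH oneH])
    finally show ?thesis by (simp add: m)
  qed
  then have "\<Phi> m id id = trace H id" by (simp add: \<Phi>_def id_def)
  also have "\<dots> = (\<lambda>x. of_nat (card H) * x)"
    using sub by (auto simp: trace_def conjugate_id fun_eq_iff subset_iff)
  finally have "(\<lambda>x. of_nat (card H) * t x) \<in> S"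
    using \<Phi>[OF m(1) id id] by (simp add: comp_def)
  moreover have "card H \<noteq> 0" using finH oneH by auto
  ultimately show "t \<in> S" by (metis subalg_of_nat_cancel[OF S])
qed

section \<open>The two halves of the correspondence: surjectivity and injectivity\<close>

lemma intermediate_subalgebra_is_diffops_inv:
  assumes simple: "diffops_simple c" and S: "diffops_subalg c S"
    and A: "diffops_inv c W act (carrier W) \<subseteq> S"
  shows "\<exists>H. subgroup H W \<and> diffops_inv c W act H = S"
proof -
  define P where "P = {x. (*) x \<in> S}"
  define H where "H = {g \<in> carrier W. \<forall>x\<in>P. act g x = x}"
  have Padd: "x + y \<in> P" if "x \<in> P" "y \<in> P" for x y
    using subalg_add[OF S, of "(*) x" "(*) y"] that by (simp add: P_def distrib_right[abs_def])
  have Pmult: "x * y \<in> P" if "x \<in> P" "y \<in> P" for x y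
    using subalg_comp[OF S, of "(*) x" "(*) y"] that by (simp add: P_def comp_def mult.assoc[abs_def])
  have Pinv: "x \<in> P" if "\<And>g. g \<in> carrier W \<Longrightarrow> act g x = x" for x
    using A that by (auto simp: P_def diffops_inv_iff mult_in_diffops conjugate_mult)
  have Pzero: "0 \<in> P" and Pone: "1 \<in> P" and Pc: "c z \<in> P" for z
    by (auto intro!: Pinv simp: act_one act_c act_zero)
  have Ppow: "x ^ n \<in> P" if "x \<in> P" for x n
    using that by (induction n) (auto intro: Pone Pmult)
  have sub: "H \<subseteq> carrier W" by (auto simp: H_def)
  have H: "subgroup H W"
  proof (rule subgroupI)
    show "H \<noteq> {}" using act_id by (auto simp: H_def)
    show "inv a \<in> H" if "a \<in> H" for a
      using that act_inv'[of a] by (auto simp: H_def) metis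
    show "a \<otimes> b \<in> H" if "a \<in> H" "b \<in> H" for a b
      using that by (auto simp: H_def act_act[symmetric])
  qed (rule sub)
  have finH: "finite H" using sub fin by (rule finite_subset)
  have cardH: "card H \<noteq> 0" using finH subgroup.one_closed[OF H] by auto
  have T: "diffops_subalg c (diffops_inv c W act H)" by (rule diffops_inv_subalg[OF sub])
  have "\<exists>\<theta>\<in>P. \<forall>g\<in>carrier W - H. act g \<theta> \<noteq> \<theta>"
    by (rule exists_generic_element) (auto simp: fin H_def Pzero intro: Padd Pmult Pc)
  then obtain \<theta> where \<theta>: "\<theta> \<in> P" "\<And>g. g \<in> carrier W - H \<Longrightarrow> act g \<theta> \<noteq> \<theta>" by auto
  obtain q where q0: "poly q \<theta> \<noteq> 0"
    and q1: "\<And>g. g \<in> carrier W \<Longrightarrow> act g \<theta> \<noteq> \<theta> \<Longrightarrow> poly q (act g \<theta>) = 0"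
    and q2: "\<And>g n. g \<in> carrier W \<Longrightarrow> act g (coeff ([:- \<theta>, 1:] * q) n) = coeff ([:- \<theta>, 1:] * q) n"
    by (rule exists_separating_polynomial[of \<theta>]) (rule that)
  define f where "f = poly q \<theta>"
  \<comment> \<open>Elements of \<open>H\<close> fix \<open>\<theta>\<close> since it lies in
    \<open>P\<close>; by genericity all others move it to a root of \<open>q\<close>.\<close>
  have q: "poly q (act g \<theta>) = (if g \<in> H then f else 0)" if "g \<in> carrier W" for g
    using that q1 \<theta> by (auto simp: f_def H_def)
  have qP: "coeff q n \<in> P" for n
    by (rule coeff_linear_factor_mem[of \<theta>]) (use q2 \<theta> in \<open>auto intro: Pinv Padd Pmult Pzero\<close>)
  have "(\<Sum>i\<le>n. coeff q i * \<theta> ^ i) \<in> P" for n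
    by (induction n) (auto intro!: Padd Pmult qP Ppow \<theta>)
  then have fP: "f \<in> P" by (simp add: f_def poly_altdef)
  have tr: "trace (carrier W) d \<in> S" if "d \<in> diffops c" for d
    using trace_in_diffops_inv[OF subgroup_self that] A by blast
  have TS: "diffops_inv c W act H \<subseteq> S"
  proof (rule diffops_inv_subset_of_conductor[OF simple S H])
    show "f \<noteq> 0" using q0 by (simp add: f_def)
    show "act h f = f" if "h \<in> H" for h using that fP by (auto simp: H_def)
  next
    fix t assume t: "t \<in> diffops_inv c W act H"
    then have tD: "t \<in> diffops c" by (simp add: diffops_inv_iff)
    \<comment> \<open>The coefficients of \<open>q\<close> lie in \<open>P\<close>, and traces over
      the whole group are in \<open>S\<close>, so each summand is in \<open>S\<close> although
      \<open>t\<close> is not yet known to be.\<close>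
    have "(*) (coeff q i) \<circ> trace (carrier W) (\<lambda>x. \<theta> ^ i * t x) \<in> S" for i
      using qP tD by (intro subalg_comp[OF S] tr mult_comp_in_diffops) (simp_all add: P_def)
    then have "(\<lambda>x. \<Sum>i\<le>degree q. ((*) (coeff q i) \<circ> trace (carrier W) (\<lambda>x. \<theta> ^ i * t x)) x) \<in> S"
      by (rule subalg_sum[OF S])
    then have "(\<lambda>x. of_nat (card H) * (f * t x)) \<in> S"
      by (simp add: sum_coeff_trace[OF sub t q])
    then show "(\<lambda>x. f * t x) \<in> S" by (rule subalg_of_nat_cancel[OF S cardH])
    have "trace (carrier W) (t \<circ> (*) (\<theta> ^ i)) \<circ> (*) (coeff q i) \<in> S" for i
      using qP tD by (intro subalg_comp[OF S] tr diffops_comp mult_in_diffops) (simp_all add: P_def)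
    then have "(\<lambda>x. \<Sum>i\<le>degree q. (trace (carrier W) (t \<circ> (*) (\<theta> ^ i)) \<circ> (*) (coeff q i)) x) \<in> S"
      by (rule subalg_sum[OF S])
    then have "(\<lambda>x. of_nat (card H) * t (f * x)) \<in> S"
      by (simp add: comp_def sum_trace_coeff[OF sub t q])
    then show "(\<lambda>x. t (f * x)) \<in> S" by (rule subalg_of_nat_cancel[OF S cardH])
  qed
  have order_0: "s \<in> diffops_inv c W act H" if "s \<in> S" "s \<in> diffops_le c 0" for s
  proof -
    obtain a where "s = (*) a" using \<open>s \<in> diffops_le c 0\<close> unfolding diffops_le_0_iff by blast
    with \<open>s \<in> S\<close> show ?thesis
      by (auto simp: diffops_inv_iff mult_in_diffops conjugate_mult H_def P_def)
  qed
  have "s \<in> diffops_inv c W act H" if "s \<in> S" "s \<in> diffops_le c n" for s n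
    using that
  proof (induction n arbitrary: s)
    case 0
    then show ?case by (intro order_0)
  next
    case (Suc n)
    have sD: "s \<in> diffops c" by (rule subalg_in_diffops[OF S Suc.prems(1)])
    have "(\<lambda>x. s x - conjugate h s x) \<in> diffops_le c 0" if h: "h \<in> H" for h
    proof (rule commutes_with_invariants_imp_order_0)
      have hc: "h \<in> carrier W" using h sub by blast
      show "(\<lambda>x. s x - conjugate h s x) \<in> diffops c" by (intro diffops_diff conjugate_diffops sD hc)
      fix a assume a: "\<And>g. g \<in> carrier W \<Longrightarrow> act g a = a"
      have "(*) a \<in> S" using Pinv[OF a] by (simp add: P_def)
      then have "mult_commutator s a \<in> S"
        using subalg_diff[OF S subalg_comp[OF S Suc.prems(1)] subalg_comp[OF S _ Suc.prems(1)], of "(*) a" "(*) a"]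
        by (simp add: mult_commutator_def)
      \<comment> \<open>The bracket of \<open>s\<close> with an invariant \<open>a\<close> lies in
        \<open>S\<close> and has lower order, so \<open>H\<close> fixes it. Since \<open>a\<close>
        is fixed too, \<open>s\<close> and its conjugate have the same bracket with
        \<open>a\<close>.\<close>
      from Suc.IH[OF this mult_commutator_in_diffops_le[OF Suc.prems(2)]]
      have "conjugate h (mult_commutator s a) = mult_commutator s a" using h by (simp add: diffops_inv_iff)
      moreover have "mult_commutator (conjugate h s) a = conjugate h (mult_commutator s a)"
        by (simp add: conjugate_mult_commutator hc a)
      moreover have "mult_commutator (\<lambda>x. s x - conjugate h s x) a =
          (\<lambda>x. mult_commutator s a x - mult_commutator (conjugate h s) a x)"
        by (simp add: mult_commutator_def fun_eq_iff algebra_simps)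
      ultimately show "mult_commutator (\<lambda>x. s x - conjugate h s x) a = (\<lambda>_. 0)" by simp
    qed
    then have "\<forall>h\<in>H. \<exists>u. (\<lambda>x. s x - conjugate h s x) = (*) u" unfolding diffops_le_0_iff by blast
    then obtain u where u: "\<And>h. h \<in> H \<Longrightarrow> (\<lambda>x. s x - conjugate h s x) = (*) (u h)" by metis
    have "of_nat (card H) * s x - trace H s x = (\<Sum>h\<in>H. s x - conjugate h s x)" for x
      by (simp add: trace_def sum_subtractf)
    also have "(\<Sum>h\<in>H. s x - conjugate h s x) = (\<Sum>h\<in>H. u h) * x" for x
      using u by (simp add: sum_distrib_right fun_eq_iff)
    finally have eq: "(\<lambda>x. of_nat (card H) * s x - trace H s x) = (*) (\<Sum>h\<in>H. u h)" by auto
    have trT: "trace H s \<in> diffops_inv c W act H" by (rule trace_in_diffops_inv[OF H sD])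
    have "(\<lambda>x. of_nat (card H) * s x) \<in> S"
      using subalg_scale[OF S Suc.prems(1), of "of_nat (card H)"] by (simp add: c_of_nat)
    \<comment> \<open>Here the inclusion \<open>TS\<close> puts the trace of \<open>s\<close> into
      \<open>S\<close>. The difference is then multiplication by an element of \<open>P\<close>,
      which \<open>H\<close> fixes by definition.\<close>
    then have "(*) (\<Sum>h\<in>H. u h) \<in> S"
      unfolding eq[symmetric] using trT TS by (intro subalg_diff[OF S]) auto
    then have "(*) (\<Sum>h\<in>H. u h) \<in> diffops_inv c W act H"
      by (rule order_0) (unfold diffops_le_0_iff, blast)
    from subalg_add[OF T this[folded eq] trT]
    have "(\<lambda>x. of_nat (card H) * s x) \<in> diffops_inv c W act H" by simp
    then show ?case by (rule subalg_of_nat_cancel[OF T cardH])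
  qed
  then have "S \<subseteq> diffops_inv c W act H"
    using subalg_in_diffops[OF S] unfolding diffops_def by blast
  with TS H show ?thesis by blast
qed

text \<open>Operators of order zero suffice. The orbit polynomial of a generic element under
  \<open>H\<close> is fixed by \<open>K\<close>, so \<open>K\<close> maps that element into its
  orbit under \<open>H\<close>.\<close>

lemma subgroup_subset_of_diffops_inv_subset:
  assumes H: "subgroup H W" and K: "subgroup K W"
    and sub: "diffops_inv c W act H \<subseteq> diffops_inv c W act K"
  shows "K \<subseteq> H"
proof
  fix g assume g: "g \<in> K"
  have Hc: "H \<subseteq> carrier W" and gc: "g \<in> carrier W"
    using g subgroup.subset[OF H] subgroup.subset[OF K] by auto
  have finH: "finite H" using Hc fin by (rule finite_subset)
  \<comment> \<open>Faithfulness lets the generic element have trivial stabiliser, so that agreement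
    on it identifies group elements.\<close>
  have "\<exists>\<theta>\<in>UNIV. \<forall>g\<in>carrier W - {\<one>}. act g \<theta> \<noteq> \<theta>"
    by (rule exists_generic_element) (use fin act_faithful in auto)
  then obtain \<theta> where \<theta>: "\<And>g. g \<in> carrier W - {\<one>} \<Longrightarrow> act g \<theta> \<noteq> \<theta>" by auto
  define Z where "Z = (\<lambda>h. act h \<theta>) ` H"
  define p where "p = (\<Prod>z\<in>Z. [:- z, 1:])"
  have finZ: "finite Z" by (simp add: Z_def finH)
  have "(*) (coeff p n) \<in> diffops_inv c W act H" for n
  proof -
    have "act h (coeff p n) = coeff p n" if h: "h \<in> H" for h
    proof -
      have hc: "h \<in> carrier W" using h Hc by blast
      have "act h ` Z \<subseteq> Z"
        using h hc Hc subgroup.m_closed[OF H h] by (auto simp: Z_def act_act subset_iff)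
      moreover have "inj_on (act h) Z" using hc by (simp add: inj_on_def act_eq_iff)
      ultimately have "bij_betw (act h) Z Z" using finZ by (simp add: bij_betw_def endo_inj_surj)
      then show ?thesis unfolding p_def using hc
        by (intro coeff_prod_linear_invariant) (auto simp: act_add act_mult act_one)
    qed
    then show ?thesis using Hc by (auto simp: diffops_inv_iff mult_in_diffops conjugate_mult)
  qed
  then have "(*) (act g (coeff p n)) = (*) (coeff p n)" for n
    using sub g unfolding conjugate_mult[OF gc, symmetric] diffops_inv_iff[of _ K] subset_iff by blast
  then have "act g (coeff p n) = coeff p n" for n by (metis mult.right_neutral)
  then have "poly p (act g \<theta>) = act g (poly p \<theta>)"
    using gc by (simp add: poly_altdef act_sum act_mult act_power)
  also have "poly p \<theta> = 0"
    using finZ act_id[of \<theta>] subgroup.one_closed[OF H] by (force simp: p_def poly_prod Z_def)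
  finally have "act g \<theta> \<in> Z" using finZ gc by (auto simp: p_def poly_prod act_zero)
  then obtain h where h: "h \<in> H" "act g \<theta> = act h \<theta>" by (auto simp: Z_def)
  have hc: "h \<in> carrier W" using h Hc by blast
  have "act (inv h \<otimes> g) \<theta> = \<theta>" using hc gc h(2) by (simp flip: act_act add: act_inv')
  then have "inv h \<otimes> g = \<one>" using \<theta>[of "inv h \<otimes> g"] hc gc by auto
  then have "g = h" using hc gc by (metis inv_equality inv_inv inv_closed)
  with h show "g \<in> H" by simp
qed

end

theorem theorem7p7:
  fixes c :: "complex \<Rightarrow> 'a::idom"
    and W :: "('g, 'b) monoid_scheme"
    and act :: "'g \<Rightarrow> 'a \<Rightarrow> 'a"
  assumes "affine_coord_ring c"
    and "integrally_closed TYPE('a)"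
    and "D_simple c"
    and "group W" and "finite (carrier W)"
    and "faithful_action c W act"
  shows "bij_betw (diffops_inv c W act) {H. subgroup H W}
           {B. diffops_subalg c B \<and> diffops_inv c W act (carrier W) \<subseteq> B}"
proof -
  have simple: "diffops_simple c" using assms(3) by (simp add: D_simple_def)
  interpret galois_action c W act
    using assms by (auto simp: galois_action_def galois_action_axioms_def complex_algebra_def
        affine_coord_ring_def)
  \<comment> \<open>Equality of invariant algebras is used as two inclusions, one for each inclusion
    of subgroups.\<close>
  have "inj_on (diffops_inv c W act) {H. subgroup H W}"
    using subgroup_subset_of_diffops_inv_subset by (intro inj_onI) (auto 4 4)
  moreover have "diffops_subalg c (diffops_inv c W act H)"
    "diffops_inv c W act (carrier W) \<subseteq> diffops_inv c W act H" if "subgroup H W" for H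
    using subgroup.subset[OF that] diffops_inv_subalg[of H] by (auto simp: diffops_inv_iff subset_iff)
  ultimately show ?thesis
    using intermediate_subalgebra_is_diffops_inv[OF simple] by (fastforce simp: bij_betw_def)
qed

end
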